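(* Let $\rho_0:\mathbb{N}\to[0,\infty)$ satisfy $m_1(\rho_0)=\sum_{j=1}^\infty j\rho_0(j)=m\in\left(0,\frac12\right)$ and $m_2(\rho_0)=\sum_{j=1}^\infty j^2\rho_0(j)<+\infty$. Let $\rho:\mathbb{N}\times[0,\infty)\to[0,\infty)$ be the unique mass-conserving solution, with $\rho(\cdot,0)=\rho_0$, of the discrete Coagulation-Fragmentation equation with kernels $a(j,k)=jk$ and $b(j,k)=1$. Then for each $l\in\mathbb{N}$ the density $\rho(l,t)$ converges, as $t\to\infty$, to a limit $\tilde\rho(l)$. Moreover, the equilibrium $\tilde\rho:\mathbb{N}\to[0,\infty)$ is the unique stationary solution of this equation with $m_1(\tilde\rho)=\sum_{l=1}^\infty l\tilde\rho(l)=m$, and it is characterized by the recursive formula, for $l\in\mathbb{N}$, $$\tilde\rho(l)=\frac{2m(1-m)}{(2m+1)l+1}+\frac{1}{(2m+1)l+1}\left(\sum_{i=1}^{l-1}i(l-i)\tilde\rho(i)\tilde\rho(l-i)-2\sum_{i=1}^{l-1}\tilde\rho(i)\right).$$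
   Context: Here $\mathbb{N}=\{1,2,3,\dots\}$; empty sums are $0$. The discrete Coagulation-Fragmentation equation with kernels $a(j,k)=jk$, $b(j,k)=1$ and initial data $\rho_0$ is, for $j\in\mathbb{N}$, $t>0$, $$\rho_t(j,t)=\frac12\sum_{k=1}^{j-1}(j-k)k\,\rho(j-k,t)\rho(k,t)-\rho(j,t)\sum_{k=1}^\infty jk\,\rho(k,t)-\frac12(j-1)\rho(j,t)+\sum_{k=1}^\infty\rho(j+k,t),\qquad \rho(j,0)=\rho_0(j).$$ A function $\rho:\mathbb{N}\times[0,\infty)\to[0,\infty)$ is called a solution if $\rho(\cdot,0)=\rho_0$ and for every bounded $g:\mathbb{N}\to\mathbb{R}$, $$\frac{d}{dt}\sum_{j=1}^\infty g(j)\rho(j,t)=\frac12\sum_{j=1}^\infty\sum_{k=1}^\infty\big(g(j+k)-g(j)-g(k)\big)jk\,\rho(j,t)\rho(k,t)-\frac12\sum_{j=1}^\infty\sum_{k=1}^{j-1}\big(g(j)-g(k)-g(j-k)\big)\rho(j,t).$$ The solution is mass-conserving if $\sum_{j=1}^\infty j\rho(j,t)=m_1(\rho_0)$ for all $t\ge0$; under the stated hypotheses a unique mass-conserving solution exists. A stationary solution is a function $\tilde\rho:\mathbb{N}\to[0,\infty)$ such that $\rho(j,t)=\tilde\rho(j)$ is a (time-independent) solution. *)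

theory Defs
  imports "HOL-Analysis.Analysis"
begin

text \<open>A function on \<open>{1,2,3,\<dots>}\<close> is represented by a function on \<^typ>\<open>nat\<close> whose value at \<open>0\<close>
  is ignored: quantifiers carry the guard \<open>j \<ge> 1\<close> and series run over \<open>{1..}\<close>.
  Likewise only times \<open>t \<ge> 0\<close> matter.\<close>

definition moment :: "nat \<Rightarrow> (nat \<Rightarrow> real) \<Rightarrow> real" where
  "moment p f = (\<Sum>\<^sub>\<infinity>j\<in>{1..}. real j ^ p * f j)"

text \<open>Right-hand side of the weak formulation of the discrete Coagulation-Fragmentation equation
  with kernels \<open>a(j,k) = j k\<close> and \<open>b(j,k) = 1\<close>, tested against \<open>g\<close>.\<close>

definition weak_rhs :: "(nat \<Rightarrow> real) \<Rightarrow> (nat \<Rightarrow> real) \<Rightarrow> real" where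
  "weak_rhs g f =
     1/2 * (\<Sum>\<^sub>\<infinity>j\<in>{1..}. \<Sum>\<^sub>\<infinity>k\<in>{1..}.
              (g (j + k) - g j - g k) * (real j * real k) * f j * f k)
   - 1/2 * (\<Sum>\<^sub>\<infinity>j\<in>{1..}. \<Sum>k=1..j-1. (g j - g k - g (j - k)) * f j)"

text \<open>The summability clause says that the series in the weak formulation converge: for \<open>g = 1\<close> the
  double series is \<open>- (\<Sum>j. j \<rho>(j,t))\<^sup>2\<close>, so a finite first moment is necessary, and it suffices for
  absolute convergence of all series and every bounded \<open>g\<close>. It has to be explicit since
  \<^const>\<open>infsum\<close> is \<open>0\<close> on families that are not summable. At \<open>t = 0\<close> the derivative is one-sided.\<close>

definition is_solution :: "(nat \<Rightarrow> real) \<Rightarrow> (nat \<Rightarrow> real \<Rightarrow> real) \<Rightarrow> bool" where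
  "is_solution \<rho>0 \<rho> \<longleftrightarrow>
     (\<forall>j\<ge>1. \<forall>t\<ge>0. 0 \<le> \<rho> j t) \<and>
     (\<forall>j\<ge>1. \<rho> j 0 = \<rho>0 j) \<and>
     (\<forall>t\<ge>0. (\<lambda>j. real j * \<rho> j t) summable_on {1..}) \<and>
     (\<forall>g. bounded (g ` {1..}) \<longrightarrow>
        (\<forall>t\<ge>0. ((\<lambda>s. \<Sum>\<^sub>\<infinity>j\<in>{1..}. g j * \<rho> j s)
                   has_real_derivative weak_rhs g (\<lambda>j. \<rho> j t)) (at t within {0..})))"

definition is_mass_conserving_solution :: "(nat \<Rightarrow> real) \<Rightarrow> (nat \<Rightarrow> real \<Rightarrow> real) \<Rightarrow> bool" where
  "is_mass_conserving_solution \<rho>0 \<rho> \<longleftrightarrow>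
     is_solution \<rho>0 \<rho> \<and> (\<forall>t\<ge>0. moment 1 (\<lambda>j. \<rho> j t) = moment 1 \<rho>0)"

definition is_stationary_solution :: "(nat \<Rightarrow> real) \<Rightarrow> bool" where
  "is_stationary_solution \<sigma> \<longleftrightarrow> is_solution \<sigma> (\<lambda>j t. \<sigma> j)"

end

theory Submission
  imports Defs
begin

text \<open>Testing the equation against indicator functions turns it into the system
  \<open>\<rho>\<^sub>l' = h\<^sub>l - ((2 m + 1) l + 1) / 2 * \<rho>\<^sub>l\<close>, where \<open>h\<^sub>l\<close> only involves \<open>\<rho>\<^sub>1, \<dots>, \<rho>\<^sub>l\<^sub>-\<^sub>1\<close> and the total number
  \<open>n = \<Sum>\<^sub>j \<rho>\<^sub>j\<close> of clusters. Testing against \<open>1\<close> gives \<open>n' = (m - m\<^sup>2 - n) / 2\<close>. Hence \<open>n\<close>, and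
  inductively every \<open>\<rho>\<^sub>l\<close>, solves a scalar linear equation with convergent forcing and converges;
  the limits satisfy the recursion. By Fatou the limit has some mass \<open>m' \<le> m\<close>. Summing the limiting
  equations over \<open>l\<close> yields \<open>(m' - m)\<^sup>2 + (m' - m) = 0\<close>, so either \<open>m' = m\<close> or \<open>m' = m - 1 < 0\<close>, and
  no mass is lost in the limit.\<close>

section \<open>The pointwise equation and the equilibrium recursion\<close>

definition coag :: "(nat \<Rightarrow> real) \<Rightarrow> nat \<Rightarrow> real" where
  "coag f l = (\<Sum>i=1..l-1. real i * real (l - i) * f i * f (l - i))"

text \<open>This is the right-hand side of the differential equation itself. With kernel
  \<open>j k\<close> the coagulation loss sums to \<open>l * f l\<close> times the first moment, and
  with constant fragmentation kernel the gain is the tail beyond \<open>l\<close>.\<close>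

definition strong_rhs :: "(nat \<Rightarrow> real) \<Rightarrow> nat \<Rightarrow> real" where
  "strong_rhs f l = coag f l / 2 - moment 1 f * (real l * f l) - (real l - 1) * f l / 2
     + (\<Sum>\<^sub>\<infinity>j\<in>{l<..}. f j)"

text \<open>Obtained by setting \<open>strong_rhs\<close> to zero and solving for
  \<open>f l\<close>, with mass \<open>m\<close> and with the equilibrium number of clusters
  \<open>m * (1 - m)\<close> in place of the infinite sum. Only values of \<open>f\<close> below
  \<open>l\<close> occur, so a fixed point on the positive integers is determined from
  below.\<close>

definition equilibrium_rec :: "real \<Rightarrow> (nat \<Rightarrow> real) \<Rightarrow> nat \<Rightarrow> real" where
  "equilibrium_rec m f l =
     (coag f l + 2 * (m * (1 - m)) - 2 * (\<Sum>i=1..l-1. f i)) / ((2 * m + 1) * real l + 1)"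

lemma coag_cong:
  assumes "\<And>i. 1 \<le> i \<Longrightarrow> i < l \<Longrightarrow> f i = g i"
  shows "coag f l = coag g l"
  unfolding coag_def by (intro sum.cong refl) (use assms in auto)

lemma equilibrium_rec_cong:
  assumes "\<And>i. 1 \<le> i \<Longrightarrow> i < l \<Longrightarrow> f i = g i"
  shows "equilibrium_rec m f l = equilibrium_rec m g l"
proof -
  have "(\<Sum>i=1..l-1. f i) = (\<Sum>i=1..l-1. g i)"
    by (intro sum.cong refl) (use assms in auto)
  then show ?thesis
    unfolding equilibrium_rec_def using coag_cong[of l f g] assms by simp
qed

lemma equilibrium_rec_unique:
  assumes f: "\<And>l. 1 \<le> l \<Longrightarrow> f l = equilibrium_rec m f l"
    and g: "\<And>l. 1 \<le> l \<Longrightarrow> g l = equilibrium_rec m g l"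
    and "1 \<le> l"
  shows "f l = g l"
  using \<open>1 \<le> l\<close>
proof (induction l rule: less_induct)
  case (less l)
  then have "equilibrium_rec m f l = equilibrium_rec m g l"
    by (intro equilibrium_rec_cong) auto
  then show ?case
    using f g less.prems by simp
qed

section \<open>Auxiliary facts on series and scalar linear equations\<close>

lemma has_sum_diff:
  fixes f g :: "'a \<Rightarrow> real"
  assumes "(f has_sum a) A" "(g has_sum b) A"
  shows "((\<lambda>x. f x - g x) has_sum a - b) A"
  using has_sum_add[OF assms(1) has_sum_uminusI[OF assms(2)]] by simp

lemma summable_on_bounded_mult:
  fixes f :: "'a \<Rightarrow> real"
  assumes "f summable_on A" "\<And>x. x \<in> A \<Longrightarrow> 0 \<le> f x" "\<And>x. x \<in> A \<Longrightarrow> \<bar>g x\<bar> \<le> B"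
  shows "(\<lambda>x. g x * f x) summable_on A"
proof -
  have "(\<lambda>x. norm (g x * f x)) summable_on A"
  proof (rule summable_on_comparison_test[OF summable_on_cmult_right[OF assms(1), of B]])
    fix x assume "x \<in> A"
    then show "norm (g x * f x) \<le> B * f x"
      using mult_right_mono[OF assms(3) assms(2), of x x] assms(2)[of x] by (simp add: abs_mult)
  qed simp
  then show ?thesis
    by (rule abs_summable_summable)
qed

text \<open>Write \<open>y\<close> as the quotient of \<open>y t * exp (a * t)\<close> by
  \<open>exp (a * t)\<close>. The numerator has derivative \<open>h t * exp (a * t)\<close>, so the
  quotient of the derivatives is \<open>h t / a\<close>, and the rule of l'Hospital gives the
  limit.\<close>

lemma linear_ode_tendsto:
  fixes y h :: "real \<Rightarrow> real"
  assumes a: "0 < a"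
    and y: "\<And>t. 0 \<le> t \<Longrightarrow> (y has_real_derivative h t - a * y t) (at t within {0..})"
    and h: "(h \<longlongrightarrow> H) at_top"
  shows "(y \<longlongrightarrow> H / a) at_top"
proof -
  have "((\<lambda>t. (y t * exp (a * t)) / exp (a * t)) \<longlongrightarrow> H / a) at_top"
  proof (rule lhospital_at_top_at_top)
    show "LIM t at_top. exp (a * t) :> at_top"
      by (rule filterlim_compose[OF exp_at_top])
        (rule filterlim_tendsto_pos_mult_at_top[OF tendsto_const a filterlim_ident])
    show "\<forall>\<^sub>F t in at_top. a * exp (a * t) \<noteq> 0"
      using a by simp
    show "\<forall>\<^sub>F t in at_top. ((\<lambda>t. y t * exp (a * t)) has_real_derivative h t * exp (a * t)) (at t)"
      \<comment> \<open>The given derivative is relative to the half-line; it is two-sided only at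
        interior points, hence for positive \<open>t\<close>.\<close>
      using eventually_gt_at_top[of 0]
    proof eventually_elim
      case (elim t)
      then have "at t within {0..} = at t"
        by (intro at_within_interior) simp
      then have [derivative_intros]: "(y has_real_derivative h t - a * y t) (at t)"
        using y[of t] elim by simp
      show ?case
        by (auto intro!: derivative_eq_intros simp: algebra_simps)
    qed
    show "\<forall>\<^sub>F t in at_top. ((\<lambda>t. exp (a * t)) has_real_derivative a * exp (a * t)) (at t)"
      by (intro always_eventually allI) (auto intro!: derivative_eq_intros)
    show "((\<lambda>t. h t * exp (a * t) / (a * exp (a * t))) \<longlongrightarrow> H / a) at_top"
      using tendsto_divide[OF h tendsto_const, of a] a by simp
  qed
  then show ?thesis
    by simp
qed

section \<open>From the weak formulation to the pointwise equation\<close>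

lemma bounded_point_indicator: "bounded ((\<lambda>j. if j = l then 1 else 0 :: real) ` A)"
  by (auto simp: bounded_iff intro!: exI[of _ 1])

context
  fixes f :: "nat \<Rightarrow> real"
  assumes nonneg: "\<And>j. 1 \<le> j \<Longrightarrow> 0 \<le> f j"
    and mass: "(\<lambda>j. real j * f j) summable_on {1..}"
begin

lemma number_summable: "f summable_on {1..}"
proof (rule summable_on_comparison_test[OF mass])
  fix j :: nat assume "j \<in> {1..}"
  then show "f j \<le> real j * f j"
    using nonneg[of j] mult_right_mono[of 1 "real j" "f j"] by simp
qed (use nonneg in auto)

lemma mass_has_sum: "((\<lambda>j. real j * f j) has_sum moment 1 f) {1..}"
  using mass by (simp add: moment_def)

lemma tail_eq: "(\<Sum>\<^sub>\<infinity>j\<in>{l<..}. f j) = infsum f {1..} - (\<Sum>i=1..l. f i)"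
proof -
  have "{1..} - {1..l} = {l<..}"
    by auto
  moreover have "infsum f ({1..} - {1..l}) = infsum f {1..} - infsum f {1..l}"
    by (rule infsum_Diff) (use number_summable in auto)
  ultimately show ?thesis
    by simp
qed

text \<open>Replacing the tail by the total number minus a partial sum makes the system triangular.
  The coefficient of \<open>f l\<close> collects \<open>2 * moment 1 f * l\<close> from coagulation,
  \<open>l - 1\<close> from fragmentation and \<open>2\<close> from the last term of the partial
  sum, all halved.\<close>

lemma strong_rhs_eq:
  assumes "1 \<le> l"
  shows "strong_rhs f l = (coag f l + 2 * infsum f {1..} - 2 * (\<Sum>i=1..l-1. f i)) / 2
    - ((2 * moment 1 f + 1) * real l + 1) / 2 * f l"
proof -
  have "(\<Sum>i=1..l. f i) = (\<Sum>i=1..l-1. f i) + f l"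
    using assms by (cases l) auto
  then show ?thesis
    unfolding strong_rhs_def tail_eq by (simp add: field_simps)
qed

text \<open>Every merger changes the number of clusters by -1 and every split by +1. The kernel
  \<open>j k\<close> turns the mergers into the square of the mass, and a cluster of size
  \<open>j\<close> has \<open>j - 1\<close> ordered splits, so only mass and number appear and the
  equation for the number closes.\<close>

lemma weak_rhs_one:
  "weak_rhs (\<lambda>_. 1) f = (moment 1 f - infsum f {1..} - (moment 1 f)\<^sup>2) / 2"
proof -
  let ?M = "moment 1 f"
  have "((\<lambda>k. (1 - 1 - 1) * (real j * real k) * f j * f k) has_sum - (real j * f j) * ?M) {1..}" for j
    using has_sum_cmult_right[OF mass_has_sum, of "- (real j * f j)"] by (simp add: algebra_simps)
  then have "(\<Sum>\<^sub>\<infinity>k\<in>{1..}. (1 - 1 - 1) * (real j * real k) * f j * f k) = (real j * f j) * - ?M" for j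
    by (simp add: infsumI)
  moreover have "(\<Sum>\<^sub>\<infinity>j\<in>{1..}. (real j * f j) * - ?M) = - ?M\<^sup>2"
    using infsumI[OF has_sum_cmult_left[OF mass_has_sum, of "- ?M"]] by (simp add: power2_eq_square)
  moreover have "((\<lambda>j. \<Sum>k=1..j-1. (1 - 1 - 1) * f j) has_sum (infsum f {1..} - ?M)) {1..}"
  proof -
    have "((\<lambda>j. f j - real j * f j) has_sum (infsum f {1..} - ?M)) {1..}"
      using number_summable by (intro has_sum_diff mass_has_sum has_sum_infsum)
    then show ?thesis
      by (rule has_sum_cong[THEN iffD1, rotated]) (auto simp: of_nat_diff algebra_simps)
  qed
  ultimately show ?thesis
    unfolding weak_rhs_def by (simp add: infsumI field_simps)
qed

text \<open>Pairs \<open>(j, k)\<close> are grouped by their sum \<open>l = j + k\<close>. The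
  family over pairs is dominated by \<open>B\<close> times the product of two first-moment series,
  so it is absolutely summable and may be regrouped.\<close>

lemma coag_has_sum:
  assumes B: "\<And>j. 1 \<le> j \<Longrightarrow> \<bar>g j\<bar> \<le> B"
  obtains C where "((\<lambda>l. g l * coag f l) has_sum C) {1..}"
    and "((\<lambda>(j, k). g (j + k) * ((real j * f j) * (real k * f k))) has_sum C) ({1..} \<times> {1..})"
proof -
  let ?a = "\<lambda>j. real j * f j"
  let ?F = "\<lambda>(j, k). g (j + k) * (?a j * ?a k)"
  have "(\<lambda>(j, k). ?a j * ?a k) summable_on ({1..} \<times> {1..})"
  proof (rule summable_on_SigmaI)
    show "((\<lambda>k. case (j, k) of (j, k) \<Rightarrow> ?a j * ?a k) has_sum ?a j * moment 1 f) {1..}" for j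
      using has_sum_cmult_right[OF mass_has_sum, of "?a j"] by simp
    show "(\<lambda>j. ?a j * moment 1 f) summable_on {1..}"
      by (rule summable_on_cmult_left[OF mass])
  qed (use nonneg in auto)
  then have "(\<lambda>p. g (fst p + snd p) * (case p of (j, k) \<Rightarrow> ?a j * ?a k)) summable_on ({1..} \<times> {1..})"
    by (rule summable_on_bounded_mult[where B = B]) (use nonneg in \<open>auto intro!: B\<close>)
  then have "?F summable_on ({1..} \<times> {1..})"
    by (simp add: case_prod_unfold)
  then obtain C where C: "(?F has_sum C) ({1..} \<times> {1..})"
    by (auto simp: summable_on_def)
  \<comment> \<open>A pair with sum \<open>l\<close> is coded by its first entry; the range
    \<open>{1..l-1}\<close> keeps both entries positive and is empty for
    \<open>l = 1\<close>.\<close>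
  let ?T = "Sigma {1..} (\<lambda>l. {1..l-1})"
  have "((\<lambda>(l, i). g l * (real i * real (l - i) * f i * f (l - i))) has_sum C) ?T"
    by (rule has_sum_reindex_bij_witness[of _ "\<lambda>(i, k). (i + k, i)" "\<lambda>(l, i). (i, l - i)", THEN iffD2, OF _ _ _ _ _ _ C])
      (auto simp: algebra_simps)
  then have "((\<lambda>l. \<Sum>i=1..l-1. g l * (real i * real (l - i) * f i * f (l - i))) has_sum C) {1..}"
    by (rule has_sum_SigmaD) (auto intro: has_sum_finiteI)
  then have "((\<lambda>l. g l * coag f l) has_sum C) {1..}"
    by (simp add: coag_def sum_distrib_left)
  then show thesis
    using C that by blast
qed

text \<open>Both series sum \<open>g k * f j\<close> over the pairs with \<open>k < j\<close>, in
  the two possible orders. Each \<open>j\<close> has \<open>j - 1\<close> partners, so the finite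
  mass gives absolute summability and hence the interchange.\<close>

lemma tail_has_sum:
  assumes B: "\<And>j. 1 \<le> j \<Longrightarrow> \<bar>g j\<bar> \<le> B"
  obtains E where "((\<lambda>l. g l * (\<Sum>\<^sub>\<infinity>j\<in>{l<..}. f j)) has_sum E) {1..}"
    and "((\<lambda>j. \<Sum>k=1..j-1. g k * f j) has_sum E) {1..}"
proof -
  let ?T = "Sigma {1::nat..} (\<lambda>j. {1..j-1})"
  let ?U = "Sigma {1::nat..} (\<lambda>l. {l<..})"
  have "(\<lambda>(j, k). f j) summable_on ?T"
  proof (rule summable_on_SigmaI)
    show "((\<lambda>k. case (j, k) of (j, k) \<Rightarrow> f j) has_sum real (j - 1) * f j) {1..j-1}" for j
      by (rule has_sum_finiteI) auto
    show "(\<lambda>j. real (j - 1) * f j) summable_on {1..}"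
      by (rule summable_on_comparison_test[OF mass]) (auto intro!: mult_right_mono mult_nonneg_nonneg nonneg)
  qed (use nonneg in auto)
  then have "(\<lambda>p. g (snd p) * (case p of (j, k) \<Rightarrow> f j)) summable_on ?T"
    by (rule summable_on_bounded_mult[where B = B]) (use nonneg in \<open>auto intro!: B\<close>)
  then obtain E where E: "((\<lambda>(j, k). g k * f j) has_sum E) ?T"
    by (auto simp: summable_on_def case_prod_unfold)
  then have "((\<lambda>j. \<Sum>k=1..j-1. g k * f j) has_sum E) {1..}"
    by (rule has_sum_SigmaD) (auto intro: has_sum_finiteI)
  moreover have "((\<lambda>(l, j). g l * f j) has_sum E) ?U"
    by (rule has_sum_reindex_bij_witness[of _ "\<lambda>(j, k). (k, j)" "\<lambda>(j, k). (k, j)", THEN iffD2, OF _ _ _ _ _ _ E])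
      auto
  then have "((\<lambda>l. g l * (\<Sum>\<^sub>\<infinity>j\<in>{l<..}. f j)) has_sum E) {1..}"
  proof (rule has_sum_SigmaD)
    fix l :: nat assume "l \<in> {1..}"
    then have "f summable_on {l<..}"
      by (intro summable_on_subset_banach[OF number_summable]) auto
    then show "((\<lambda>j. case (l, j) of (l, j) \<Rightarrow> g l * f j) has_sum g l * (\<Sum>\<^sub>\<infinity>j\<in>{l<..}. f j)) {l<..}"
      by (auto intro: has_sum_cmult_right)
  qed
  ultimately show thesis
    using that by blast
qed

text \<open>Both sides are reduced to the same sums: \<open>C\<close> for coagulation gain,
  \<open>S\<close> and \<open>N\<close> for \<open>g\<close> against mass and number,
  \<open>E\<close> for fragmentation gain. The symmetry of the kernel makes the two coagulation
  losses equal, and swapping the two fragments of a split does the same for the fragmentation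
  gains.\<close>

lemma weak_rhs_has_sum:
  assumes "bounded (g ` {1..})"
  shows "((\<lambda>l. g l * strong_rhs f l) has_sum weak_rhs g f) {1..}"
proof -
  let ?M = "moment 1 f" and ?a = "\<lambda>j. real j * f j"
  obtain B where B: "\<And>j. 1 \<le> j \<Longrightarrow> \<bar>g j\<bar> \<le> B"
    using assms by (auto simp: bounded_iff)
  obtain C where C: "((\<lambda>l. g l * coag f l) has_sum C) {1..}"
    "((\<lambda>(j, k). g (j + k) * (?a j * ?a k)) has_sum C) ({1..} \<times> {1..})"
    using coag_has_sum[of g B] B by blast
  obtain E where E: "((\<lambda>l. g l * (\<Sum>\<^sub>\<infinity>j\<in>{l<..}. f j)) has_sum E) {1..}"
    "((\<lambda>j. \<Sum>k=1..j-1. g k * f j) has_sum E) {1..}"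
    using tail_has_sum[of g B] B by blast
  have "(\<lambda>j. g j * ?a j) summable_on {1..}"
    by (rule summable_on_bounded_mult[OF mass, where B = B]) (use nonneg in \<open>auto intro!: B\<close>)
  then obtain S where S: "((\<lambda>j. g j * ?a j) has_sum S) {1..}"
    by (auto simp: summable_on_def)
  have "(\<lambda>j. g j * f j) summable_on {1..}"
    by (rule summable_on_bounded_mult[OF number_summable, where B = B]) (use nonneg in \<open>auto intro!: B\<close>)
  then obtain N where N: "((\<lambda>j. g j * f j) has_sum N) {1..}"
    by (auto simp: summable_on_def)
  \<comment> \<open>\<open>weak_rhs\<close> contains an iterated sum, whereas \<open>C\<close> is a
    sum over pairs; \<open>G\<close> is the inner sum that links them.\<close>
  define G where "G j = (\<Sum>\<^sub>\<infinity>k\<in>{1..}. g (j + k) * (?a j * ?a k))" for j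
  have G: "((\<lambda>k. g (j + k) * (?a j * ?a k)) has_sum G j) {1..}" if "1 \<le> j" for j
  proof -
    have "(\<lambda>k. ?a j * ?a k) summable_on {1..}"
      by (rule summable_on_cmult_right[OF mass])
    then have "(\<lambda>k. g (j + k) * (?a j * ?a k)) summable_on {1..}"
      by (rule summable_on_bounded_mult[where B = B]) (use that nonneg in \<open>auto intro!: B\<close>)
    then show ?thesis
      unfolding G_def by (rule has_sum_infsum)
  qed
  have GC: "(G has_sum C) {1..}"
    using C(2) by (rule has_sum_SigmaD) (use G in auto)
  have inner: "(\<Sum>\<^sub>\<infinity>k\<in>{1..}. (g (j + k) - g j - g k) * (real j * real k) * f j * f k)
      = G j - g j * ?a j * ?M - ?a j * S" if "1 \<le> j" for j
  proof -
    have "((\<lambda>k. g (j + k) * (?a j * ?a k) - g j * ?a j * ?a k - ?a j * (g k * ?a k))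
        has_sum G j - g j * ?a j * ?M - ?a j * S) {1..}"
      by (intro has_sum_diff has_sum_cmult_right G mass_has_sum S that)
    then show ?thesis
      by (intro infsumI) (simp add: algebra_simps)
  qed
  have "((\<lambda>j. G j - g j * ?a j * ?M - ?a j * S) has_sum C - S * ?M - ?M * S) {1..}"
    by (intro has_sum_diff has_sum_cmult_left GC mass_has_sum S)
  then have "(\<Sum>\<^sub>\<infinity>j\<in>{1..}. G j - g j * ?a j * ?M - ?a j * S) = C - 2 * ?M * S"
    by (simp add: infsumI)
  moreover have "(\<Sum>\<^sub>\<infinity>j\<in>{1..}. \<Sum>\<^sub>\<infinity>k\<in>{1..}.
      (g (j + k) - g j - g k) * (real j * real k) * f j * f k)
      = (\<Sum>\<^sub>\<infinity>j\<in>{1..}. G j - g j * ?a j * ?M - ?a j * S)"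
    by (rule infsum_cong, rule inner) simp
  ultimately have outer: "(\<Sum>\<^sub>\<infinity>j\<in>{1..}. \<Sum>\<^sub>\<infinity>k\<in>{1..}.
      (g (j + k) - g j - g k) * (real j * real k) * f j * f k) = C - 2 * ?M * S"
    by simp
  have frag: "(\<Sum>k=1..j-1. (g j - g k - g (j - k)) * f j)
      = g j * ?a j - g j * f j - 2 * (\<Sum>k=1..j-1. g k * f j)" if "1 \<le> j" for j
  proof -
    \<comment> \<open>Reflection of \<open>k\<close> to \<open>j - k\<close> exchanges the two
      fragments.\<close>
    have "(\<Sum>k=1..j-1. g (j - k) * f j) = (\<Sum>k=1..j-1. g k * f j)"
      by (rule sum.reindex_bij_witness[of _ "\<lambda>k. j - k" "\<lambda>k. j - k"]) auto
    then show ?thesis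
      using that by (simp add: algebra_simps sum_subtractf sum.distrib of_nat_diff)
  qed
  have "((\<lambda>j. g j * ?a j - g j * f j - 2 * (\<Sum>k=1..j-1. g k * f j)) has_sum S - N - 2 * E) {1..}"
    by (intro has_sum_diff has_sum_cmult_right S N E)
  then have "(\<Sum>\<^sub>\<infinity>j\<in>{1..}. g j * ?a j - g j * f j - 2 * (\<Sum>k=1..j-1. g k * f j)) = S - N - 2 * E"
    by (rule infsumI)
  moreover have "(\<Sum>\<^sub>\<infinity>j\<in>{1..}. \<Sum>k=1..j-1. (g j - g k - g (j - k)) * f j)
      = (\<Sum>\<^sub>\<infinity>j\<in>{1..}. g j * ?a j - g j * f j - 2 * (\<Sum>k=1..j-1. g k * f j))"
    by (rule infsum_cong, rule frag) simp
  ultimately have "(\<Sum>\<^sub>\<infinity>j\<in>{1..}. \<Sum>k=1..j-1. (g j - g k - g (j - k)) * f j) = S - N - 2 * E"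
    by simp
  with outer have weak: "weak_rhs g f = 1/2 * C - ?M * S - 1/2 * (S - N) + E"
    unfolding weak_rhs_def by (simp only:) (simp add: field_simps)
  have "((\<lambda>l. 1/2 * (g l * coag f l) - ?M * (g l * ?a l) - 1/2 * (g l * ?a l - g l * f l)
      + g l * (\<Sum>\<^sub>\<infinity>j\<in>{l<..}. f j)) has_sum weak_rhs g f) {1..}"
    unfolding weak by (intro has_sum_add has_sum_diff has_sum_cmult_right C S N E)
  then show ?thesis
    by (rule has_sum_cong[THEN iffD1, rotated]) (simp add: strong_rhs_def field_simps)
qed

lemma weak_rhs_indicator:
  assumes "1 \<le> l"
  shows "weak_rhs (\<lambda>j. if j = l then 1 else 0) f = strong_rhs f l"
proof -
  from weak_rhs_has_sum[OF bounded_point_indicator]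
  have "((\<lambda>j. (if j = l then 1 else 0) * strong_rhs f j)
      has_sum weak_rhs (\<lambda>j. if j = l then 1 else 0) f) {1..}" .
  moreover have "((\<lambda>j. (if j = l then 1 else 0) * strong_rhs f j) has_sum strong_rhs f l) {1..}"
    by (rule has_sum_finite_neutralI[of "{l}"]) (use assms in auto)
  ultimately show ?thesis
    by (rule has_sum_unique)
qed

end

section \<open>Stationary solutions, long-time limits and the recursion\<close>

lemma stationary_imp_equilibrium_rec:
  assumes sol: "is_stationary_solution \<sigma>" and mass: "moment 1 \<sigma> = m" "0 < m" and "1 \<le> l"
  shows "\<sigma> l = equilibrium_rec m \<sigma> l"
proof -
  have nn: "\<And>j. 1 \<le> j \<Longrightarrow> 0 \<le> \<sigma> j" and sm: "(\<lambda>j. real j * \<sigma> j) summable_on {1..}"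
    using sol order_refl[of "0::real"] unfolding is_stationary_solution_def is_solution_def by blast+
  have zero: "weak_rhs g \<sigma> = 0" if "bounded (g ` {1..})" for g
  proof -
    \<comment> \<open>Time 1 is an interior point of the half-line, so the derivative there is
      two-sided and must agree with that of a constant.\<close>
    have "((\<lambda>s::real. \<Sum>\<^sub>\<infinity>j\<in>{1..}. g j * \<sigma> j) has_real_derivative weak_rhs g \<sigma>) (at 1 within {0..})"
      using sol that unfolding is_stationary_solution_def is_solution_def by simp
    moreover have "at 1 within {0..} = at (1::real)"
      by (rule at_within_interior) simp
    ultimately show ?thesis
      using DERIV_unique DERIV_const by metis
  qed
  have "bounded ((\<lambda>_. 1 :: real) ` {1::nat..})"
    by (simp add: image_constant_conv)
  from zero[OF this] have n: "infsum \<sigma> {1..} = m * (1 - m)"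
    using weak_rhs_one[OF nn sm] mass by (simp add: algebra_simps power2_eq_square)
  from zero[OF bounded_point_indicator] have "strong_rhs \<sigma> l = 0"
    using weak_rhs_indicator[OF nn sm \<open>1 \<le> l\<close>] by simp
  then have "coag \<sigma> l + 2 * (m * (1 - m)) - 2 * (\<Sum>i=1..l-1. \<sigma> i) = ((2 * m + 1) * real l + 1) * \<sigma> l"
    using strong_rhs_eq[OF nn sm \<open>1 \<le> l\<close>] n mass by simp
  moreover have "(2 * m + 1) * real l + 1 > 0"
    using \<open>0 < m\<close> by (simp add: add_nonneg_pos)
  ultimately show ?thesis
    unfolding equilibrium_rec_def by simp
qed

lemma mass_conserving_imp_tendsto:
  assumes sol: "is_mass_conserving_solution \<rho>0 \<rho>" and mass: "moment 1 \<rho>0 = m" "0 < m"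
  shows "((\<lambda>t. \<Sum>\<^sub>\<infinity>j\<in>{1..}. \<rho> j t) \<longlongrightarrow> m * (1 - m)) at_top"
    and "\<exists>r. \<forall>l\<ge>1. (\<rho> l \<longlongrightarrow> r l) at_top \<and> r l = equilibrium_rec m r l"
proof -
  define n where "n t = (\<Sum>\<^sub>\<infinity>j\<in>{1..}. \<rho> j t)" for t
  have nn: "0 \<le> \<rho> j t" if "1 \<le> j" "0 \<le> t" for j t
    using sol that by (simp add: is_mass_conserving_solution_def is_solution_def)
  have sm: "(\<lambda>j. real j * \<rho> j t) summable_on {1..}" and M: "moment 1 (\<lambda>j. \<rho> j t) = m" if "0 \<le> t" for t
    using sol mass that by (simp_all add: is_mass_conserving_solution_def is_solution_def)
  have deriv: "((\<lambda>s. \<Sum>\<^sub>\<infinity>j\<in>{1..}. g j * \<rho> j s) has_real_derivative weak_rhs g (\<lambda>j. \<rho> j t)) (at t within {0..})"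
    if "bounded (g ` {1..})" "0 \<le> t" for g t
    using sol that by (simp add: is_mass_conserving_solution_def is_solution_def)
  have "(n has_real_derivative (m - m\<^sup>2) / 2 - 1/2 * n t) (at t within {0..})" if "0 \<le> t" for t
  proof -
    have "weak_rhs (\<lambda>_. 1) (\<lambda>j. \<rho> j t) = (m - m\<^sup>2) / 2 - 1/2 * n t"
      using weak_rhs_one[of "\<lambda>j. \<rho> j t"] nn sm M that by (simp add: n_def field_simps)
    then show ?thesis
      using deriv[of "\<lambda>_. 1" t] that by (simp add: n_def[abs_def] image_constant_conv)
  qed
  from linear_ode_tendsto[OF _ this tendsto_const]
  have "(n \<longlongrightarrow> (m - m\<^sup>2) / 2 / (1/2)) at_top"
    by simp
  moreover have "(m - m\<^sup>2) / 2 / (1/2) = m * (1 - m)"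
    by (simp add: field_simps power2_eq_square)
  ultimately have n_lim: "(n \<longlongrightarrow> m * (1 - m)) at_top"
    by simp
  then show "((\<lambda>t. \<Sum>\<^sub>\<infinity>j\<in>{1..}. \<rho> j t) \<longlongrightarrow> m * (1 - m)) at_top"
    by (simp add: n_def[abs_def])
  \<comment> \<open>Stated for arbitrary \<open>r\<close> with the limits assumed only below
    \<open>l\<close>: it serves first in the induction for existence of limits and again to identify
    them.\<close>
  have step: "(\<rho> l \<longlongrightarrow> equilibrium_rec m r l) at_top"
    if "1 \<le> l" and r: "\<And>i. 1 \<le> i \<Longrightarrow> i < l \<Longrightarrow> (\<rho> i \<longlongrightarrow> r i) at_top" for l r
  proof -
    let ?A = "(2 * m + 1) * real l + 1"
    let ?h = "\<lambda>t. (coag (\<lambda>j. \<rho> j t) l + 2 * n t - 2 * (\<Sum>i=1..l-1. \<rho> i t)) / 2"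
    let ?H = "(coag r l + 2 * (m * (1 - m)) - 2 * (\<Sum>i=1..l-1. r i)) / 2"
    have A: "0 < ?A"
      using \<open>0 < m\<close> by (simp add: add_nonneg_pos)
    have coag_lim: "((\<lambda>t. coag (\<lambda>j. \<rho> j t) l) \<longlongrightarrow> coag r l) at_top"
      unfolding coag_def by (intro tendsto_intros r) auto
    have "(?h \<longlongrightarrow> ?H) at_top"
      by (intro tendsto_intros coag_lim n_lim r) auto
    moreover have "(\<rho> l has_real_derivative ?h t - ?A / 2 * \<rho> l t) (at t within {0..})" if "0 \<le> t" for t
    proof -
      have "(\<Sum>\<^sub>\<infinity>j\<in>{1..}. (if j = l then 1 else 0) * \<rho> j s) = \<rho> l s" for s
        by (rule infsumI, rule has_sum_finite_neutralI[of "{l}"]) (use \<open>1 \<le> l\<close> in auto)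
      then have "(\<rho> l has_real_derivative strong_rhs (\<lambda>j. \<rho> j t) l) (at t within {0..})"
        using deriv[OF bounded_point_indicator, of t l] that
          weak_rhs_indicator[of "\<lambda>j. \<rho> j t", OF nn sm \<open>1 \<le> l\<close>] by simp
      then show ?thesis
        using strong_rhs_eq[of "\<lambda>j. \<rho> j t", OF nn sm \<open>1 \<le> l\<close>] M that by (simp add: n_def)
    qed
    ultimately have "(\<rho> l \<longlongrightarrow> ?H / (?A / 2)) at_top"
      using A by (intro linear_ode_tendsto[of "?A / 2" _ ?h]) auto
    moreover have "x / 2 / (?A / 2) = x / ?A" for x
      by simp
    ultimately show ?thesis
      unfolding equilibrium_rec_def by metis
  qed
  have "\<exists>L. (\<rho> l \<longlongrightarrow> L) at_top" if "1 \<le> l" for l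
    using that
  proof (induction l rule: less_induct)
    case (less l)
    then obtain r where "\<And>i. 1 \<le> i \<Longrightarrow> i < l \<Longrightarrow> (\<rho> i \<longlongrightarrow> r i) at_top"
      by metis
    from step[OF less.prems this] show ?case
      by blast
  qed
  then obtain r where r: "\<And>l. 1 \<le> l \<Longrightarrow> (\<rho> l \<longlongrightarrow> r l) at_top"
    by metis
  \<comment> \<open>All limits are now collected in a single \<open>r\<close>; a second use of
    \<open>step\<close> and uniqueness of limits give the recursion.\<close>
  have "r l = equilibrium_rec m r l" if "1 \<le> l" for l
    using tendsto_unique[OF _ r[OF that] step[of l r, OF that r]] by simp
  with r show "\<exists>r. \<forall>l\<ge>1. (\<rho> l \<longlongrightarrow> r l) at_top \<and> r l = equilibrium_rec m r l"
    by blast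
qed

text \<open>The recursion carries \<open>m\<close> in its coefficients, while the mass of
  \<open>r\<close> is not yet known to be \<open>m\<close>. The mismatch leaves the defect
  \<open>(m - ?M) * (real l * r l)\<close> in the pointwise equation. Comparing its sum with
  \<open>weak_rhs_one\<close> gives a quadratic in \<open>?M\<close> with roots \<open>m\<close> and
  \<open>m - 1\<close>, the latter negative. Once \<open>?M = m\<close>, the defect vanishes for
  every \<open>l\<close>, so \<open>weak_rhs g r\<close> vanishes for every bounded
  \<open>g\<close>.\<close>

lemma equilibrium_rec_imp_stationary:
  assumes nn: "\<And>j. 1 \<le> j \<Longrightarrow> 0 \<le> r j"
    and sm: "(\<lambda>j. real j * r j) summable_on {1..}"
    and n: "infsum r {1..} = m * (1 - m)"
    and m: "0 < m" "m < 1"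
    and rec: "\<And>l. 1 \<le> l \<Longrightarrow> r l = equilibrium_rec m r l"
  shows "moment 1 r = m" and "is_stationary_solution r"
proof -
  let ?M = "moment 1 r"
  have defect: "strong_rhs r l = (m - ?M) * (real l * r l)" if "1 \<le> l" for l
  proof -
    have "(2 * m + 1) * real l + 1 > 0"
      using m by (simp add: add_nonneg_pos)
    then have "((2 * m + 1) * real l + 1) * r l
        = coag r l + 2 * (m * (1 - m)) - 2 * (\<Sum>i=1..l-1. r i)"
      using rec[OF that] by (simp add: equilibrium_rec_def field_simps)
    then have "strong_rhs r l = ((2 * m + 1) * real l + 1) / 2 * r l - ((2 * ?M + 1) * real l + 1) / 2 * r l"
      using strong_rhs_eq[OF nn sm that] n by simp
    also have "\<dots> = (m - ?M) * (real l * r l)"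
      by (simp add: field_simps)
    finally show ?thesis .
  qed
  have "((\<lambda>l. 1 * strong_rhs r l) has_sum weak_rhs (\<lambda>_. 1) r) {1..}"
    by (rule weak_rhs_has_sum[OF nn sm]) (simp_all add: image_constant_conv)
  moreover have "((\<lambda>l. 1 * strong_rhs r l) has_sum (m - ?M) * ?M) {1..}"
    using has_sum_cmult_right[OF mass_has_sum[OF nn sm], of "m - ?M"]
    by (rule has_sum_cong[THEN iffD1, rotated]) (auto simp: defect)
  ultimately have "(m - ?M) * ?M = (?M - m * (1 - m) - ?M\<^sup>2) / 2"
    using has_sum_unique weak_rhs_one[OF nn sm] n by fastforce
  then have "(?M - m) * (?M - m + 1) = 0"
    by (simp add: field_simps power2_eq_square)
  moreover have "0 \<le> ?M"
    unfolding moment_def by (rule infsum_nonneg) (use nn in auto)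
  ultimately show M: "?M = m"
    using m by auto
  have "weak_rhs g r = 0" if "bounded (g ` {1..})" for g
  proof -
    have "((\<lambda>l. g l * strong_rhs r l) has_sum 0) {1..}"
      by (rule has_sum_0) (use defect M in auto)
    then show ?thesis
      using weak_rhs_has_sum[OF nn sm that] has_sum_unique by blast
  qed
  then show "is_stationary_solution r"
    unfolding is_stationary_solution_def is_solution_def using nn sm by simp
qed

section \<open>Passage to the limit in the mass and in the number of clusters\<close>

theorem theorem1p4:
  fixes \<rho>0 :: "nat \<Rightarrow> real" and \<rho> :: "nat \<Rightarrow> real \<Rightarrow> real" and m :: real
  assumes "\<And>j. j \<ge> 1 \<Longrightarrow> 0 \<le> \<rho>0 j"
    and "(\<lambda>j. real j * \<rho>0 j) summable_on {1..}"
    and "moment 1 \<rho>0 = m"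
    and "0 < m" and "m < 1/2"
    and "(\<lambda>j. real j ^ 2 * \<rho>0 j) summable_on {1..}"
    and "is_mass_conserving_solution \<rho>0 \<rho>"
  shows "\<exists>\<rho>s :: nat \<Rightarrow> real.
     (\<forall>l\<ge>1. ((\<lambda>t. \<rho> l t) \<longlongrightarrow> \<rho>s l) at_top) \<and>
     is_stationary_solution \<rho>s \<and> moment 1 \<rho>s = m \<and>
     (\<forall>\<sigma>. is_stationary_solution \<sigma> \<and> moment 1 \<sigma> = m \<longrightarrow> (\<forall>l\<ge>1. \<sigma> l = \<rho>s l)) \<and>
     (\<forall>\<sigma> :: nat \<Rightarrow> real.
        (\<forall>l\<ge>1. \<sigma> l = 2 * m * (1 - m) / ((2 * m + 1) * real l + 1)
                 + 1 / ((2 * m + 1) * real l + 1)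
                   * ((\<Sum>i=1..l-1. real i * real (l - i) * \<sigma> i * \<sigma> (l - i))
                      - 2 * (\<Sum>i=1..l-1. \<sigma> i)))
        \<longleftrightarrow> (\<forall>l\<ge>1. \<sigma> l = \<rho>s l))"
proof -
  note sol = \<open>is_mass_conserving_solution \<rho>0 \<rho>\<close>
  note n_lim = mass_conserving_imp_tendsto(1)[OF sol \<open>moment 1 \<rho>0 = m\<close> \<open>0 < m\<close>]
  obtain r where lim: "\<And>l. 1 \<le> l \<Longrightarrow> (\<rho> l \<longlongrightarrow> r l) at_top"
    and rec: "\<And>l. 1 \<le> l \<Longrightarrow> r l = equilibrium_rec m r l"
    using mass_conserving_imp_tendsto(2)[OF sol \<open>moment 1 \<rho>0 = m\<close> \<open>0 < m\<close>] by blast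
  have nn: "0 \<le> \<rho> j t" if "1 \<le> j" "0 \<le> t" for j t
    using sol that by (simp add: is_mass_conserving_solution_def is_solution_def)
  have sm: "(\<lambda>j. real j * \<rho> j t) summable_on {1..}"
    and M: "moment 1 (\<lambda>j. \<rho> j t) = m" if "0 \<le> t" for t
    using sol that \<open>moment 1 \<rho>0 = m\<close> by (simp_all add: is_mass_conserving_solution_def is_solution_def)
  have M_sum: "((\<lambda>j. real j * \<rho> j t) has_sum m) {1..}" if "0 \<le> t" for t
    using mass_has_sum[of "\<lambda>j. \<rho> j t"] nn sm M that by simp
  have number_sum: "(\<lambda>j. \<rho> j t) summable_on {1..}" if "0 \<le> t" for t
    by (rule number_summable) (use nn sm that in auto)
  have ev: "\<forall>\<^sub>F t in at_top. (0::real) \<le> t"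
    by (rule eventually_ge_at_top)
  have rnn: "0 \<le> r j" if "1 \<le> j" for j
    by (rule tendsto_lowerbound[OF lim[OF that] eventually_mono[OF ev]]) (auto intro: nn that)
  \<comment> \<open>Fatou on finite sets: this gives summability of the limiting mass, but only an
    upper bound for it.\<close>
  have mass_le: "(\<Sum>j\<in>F. real j * r j) \<le> m" if "finite F" "F \<subseteq> {1..}" for F
  proof (rule tendsto_upperbound)
    show "((\<lambda>t. \<Sum>j\<in>F. real j * \<rho> j t) \<longlongrightarrow> (\<Sum>j\<in>F. real j * r j)) at_top"
      by (intro tendsto_intros lim) (use that in auto)
    show "\<forall>\<^sub>F t in at_top. (\<Sum>j\<in>F. real j * \<rho> j t) \<le> m"
      using ev by eventually_elim
        (rule finite_sum_le_has_sum[OF M_sum that], auto intro!: nn mult_nonneg_nonneg)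
  qed simp
  have rsm: "(\<lambda>j. real j * r j) summable_on {1..}"
    by (intro nonneg_bdd_above_summable_on bdd_aboveI2[of _ _ m]) (auto intro!: mult_nonneg_nonneg rnn mass_le)
  \<comment> \<open>Markov's inequality: at most \<open>m / J\<close> clusters are larger than
    \<open>J\<close>, uniformly in time. This tightness keeps the number of clusters from escaping
    to infinity.\<close>
  have tail: "infsum (\<lambda>j. \<rho> j t) {1..} \<le> (\<Sum>j=1..J. \<rho> j t) + m / real J"
    if "0 \<le> t" "1 \<le> J" for t and J :: nat
  proof -
    have summable: "(\<lambda>j. \<rho> j t) summable_on {J<..}"
      by (rule summable_on_subset_banach[OF number_sum]) (use that in auto)
    have "real J * (\<Sum>\<^sub>\<infinity>j\<in>{J<..}. \<rho> j t) = (\<Sum>\<^sub>\<infinity>j\<in>{J<..}. real J * \<rho> j t)"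
      by (simp add: infsum_cmult_right')
    also have "\<dots> \<le> (\<Sum>\<^sub>\<infinity>j\<in>{1..}. real j * \<rho> j t)"
      by (rule infsum_mono_neutral)
        (use summable sm nn that in \<open>auto intro!: summable_on_cmult_right mult_right_mono\<close>)
    also have "\<dots> = m"
      using M_sum that infsumI by blast
    finally have "(\<Sum>\<^sub>\<infinity>j\<in>{J<..}. \<rho> j t) \<le> m / real J"
      using that by (simp add: field_simps)
    then show ?thesis
      using tail_eq[of "\<lambda>j. \<rho> j t" J] nn sm that by simp
  qed
  have partial: "((\<lambda>t. \<Sum>j=1..J. \<rho> j t) \<longlongrightarrow> (\<Sum>j=1..J. r j)) at_top" for J
    by (intro tendsto_intros lim) auto
  have rs: "r summable_on {1..}"
    by (rule number_summable[OF rnn rsm])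
  have "infsum r {1..} \<le> m * (1 - m)"
  proof (rule has_sum_le_finite_sums[OF has_sum_infsum[OF rs]])
    fix F :: "nat set" assume F: "finite F" "F \<subseteq> {1..}"
    show "sum r F \<le> m * (1 - m)"
    proof (rule tendsto_le[OF _ n_lim])
      show "((\<lambda>t. \<Sum>j\<in>F. \<rho> j t) \<longlongrightarrow> sum r F) at_top"
        by (intro tendsto_intros lim) (use F in auto)
      show "\<forall>\<^sub>F t in at_top. (\<Sum>j\<in>F. \<rho> j t) \<le> (\<Sum>\<^sub>\<infinity>j\<in>{1..}. \<rho> j t)"
        using ev by eventually_elim
          (rule finite_sum_le_infsum[OF number_sum F], auto intro: nn)
    qed simp
  qed
  \<comment> \<open>The order of limits matters: first \<open>t\<close> tends to infinity with
    \<open>J\<close> fixed, where only finitely many densities are involved, then \<open>J\<close>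
    does.\<close>
  moreover have "m * (1 - m) \<le> infsum r {1..}"
  proof (rule tendsto_upperbound)
    show "((\<lambda>J. m * (1 - m) - m / real J) \<longlongrightarrow> m * (1 - m)) sequentially"
      using tendsto_diff[OF tendsto_const lim_const_over_n] by fastforce
    show "\<forall>\<^sub>F J in sequentially. m * (1 - m) - m / real J \<le> infsum r {1..}"
      using eventually_ge_at_top[of 1]
    proof eventually_elim
      case (elim J)
      have "\<forall>\<^sub>F t in at_top. (\<Sum>\<^sub>\<infinity>j\<in>{1..}. \<rho> j t) \<le> (\<Sum>j=1..J. \<rho> j t) + m / real J"
        using ev by eventually_elim (rule tail[OF _ elim])
      then have "m * (1 - m) \<le> (\<Sum>j=1..J. r j) + m / real J"
        by (rule tendsto_le[OF _ tendsto_add[OF partial tendsto_const] n_lim, rotated]) simp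
      also have "(\<Sum>j=1..J. r j) \<le> infsum r {1..}"
        by (rule finite_sum_le_infsum[OF rs]) (auto intro: rnn)
      finally show ?case
        by simp
    qed
  qed simp
  ultimately have rn: "infsum r {1..} = m * (1 - m)"
    by simp
  note stat = equilibrium_rec_imp_stationary[OF rnn rsm rn \<open>0 < m\<close> _ rec]
  have "m < 1"
    using \<open>m < 1/2\<close> by simp
  have uniq: "\<sigma> l = r l" if "\<And>l. 1 \<le> l \<Longrightarrow> \<sigma> l = equilibrium_rec m \<sigma> l" "1 \<le> l" for \<sigma> l
    using equilibrium_rec_unique[OF that(1) rec that(2)] .
  have form: "2 * m * (1 - m) / ((2 * m + 1) * real l + 1)
      + 1 / ((2 * m + 1) * real l + 1)
        * ((\<Sum>i=1..l-1. real i * real (l - i) * \<sigma> i * \<sigma> (l - i)) - 2 * (\<Sum>i=1..l-1. \<sigma> i))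
      = equilibrium_rec m \<sigma> l" for \<sigma> l
    unfolding equilibrium_rec_def coag_def by (simp add: add_divide_distrib diff_divide_distrib)
  have equil: "(\<forall>l\<ge>1. \<sigma> l = equilibrium_rec m \<sigma> l) \<longleftrightarrow> (\<forall>l\<ge>1. \<sigma> l = r l)" for \<sigma>
  proof (intro iffI allI impI)
    fix l :: nat assume "\<forall>l\<ge>1. \<sigma> l = r l" "1 \<le> l"
    then show "\<sigma> l = equilibrium_rec m \<sigma> l"
      using rec[of l] equilibrium_rec_cong[of l \<sigma> r m] by simp
  qed (use uniq in blast)
  \<comment> \<open>Uniqueness among stationary solutions of mass \<open>m\<close> reduces to
    uniqueness for the recursion, which each of them satisfies.\<close>
  show ?thesis
    unfolding form equil
    using lim stat \<open>m < 1\<close> uniq stationary_imp_equilibrium_rec[OF _ _ \<open>0 < m\<close>]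
    by (intro exI[of _ r]) blast
qed

end
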